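(* Let $n\ge 2$, let $G$ be the complete graph on $n$ vertices and let $I=I(G)$ be its edge ideal. For $1\le s\le n-1$ we have $I^{(s)}=I^s+(D(s))$. For any $s\ge n$ we have $$I^{(s)}=\sum_{\substack{(r_1,\ldots,r_{n-1})\\ s=r_1+2r_2+\cdots+(n-1)r_{n-1}}} I^{r_1}\,\bigl(I^{(2)}\bigr)^{r_2}\cdots\bigl(I^{(n-1)}\bigr)^{r_{n-1}},$$ where the sum is over tuples of nonnegative integers.
   Context: Let $k$ be a field and let $R=k[x_1,\ldots,x_n]$, where $x_1,\ldots,x_n$ are the vertices of $G$. The edge ideal $I(G)\subseteq R$ is generated by the products $x_ix_j$ with $\{x_i,x_j\}$ an edge. The $s$-th symbolic power of an ideal $I$ is $I^{(s)}=\bigcap_{p\in\operatorname{Ass} I}(I^sR_p\cap R)$; for an edge ideal it equals $\bigcap_V P_V^s$, where $V$ runs over the minimal vertex covers of $G$ and $P_V$ is the ideal generated by the variables in $V$. For a set of vertices $V$ and a monomial $M=x_1^{a_1}\cdots x_n^{a_n}$, $W_V(M)=\sum_{x_i\in V}a_i$. For $t\ge 1$, $D(t)$ is the set of monomials $M$ with $\deg M<2t$ and $W_V(M)\ge t$ for all minimal vertex covers $V$ of $G$; $(D(t))$ is the ideal it generates. The zeroth power of an ideal is $R$. *)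

theory Defs
  imports
    "HOL-Algebra.Algebraic_Closure_Type"
    "HOL-Algebra.Ideal_Product"
    "HOL-Computational_Algebra.Polynomial_Factorial"
    "HOL-Library.Poly_Mapping"
begin

text \<open>
  A commutative ring is given by a type of class \<^class>\<open>comm_ring_1\<close>; \<^const>\<open>ring_of_type_algebra\<close>
  turns it into a \<open>HOL-Algebra\<close> ring, whose notions of ideal are used throughout.
  In \<open>ideals\<close>, multiplication is the product of ideals, addition is the sum of ideals,
  and the unit (hence the zeroth power of any ideal) is the whole ring.
\<close>

abbreviation ideals :: "'a::comm_ring_1 set ring"
  where "ideals \<equiv> ideals_set ring_of_type_algebra"

text \<open>The localization of a domain at a prime ideal \<open>p\<close>, as a subring of its field of fractions.\<close>

definition localization :: "'a::idom set \<Rightarrow> 'a fract ring"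
  where "localization p = ring_of_type_algebra\<lparr>carrier := {Fract a b | a b. b \<notin> p}\<rparr>"

text \<open>The contraction \<open>J R\<^sub>p \<inter> R\<close> of the ideal generated by \<open>J\<close> in \<open>R\<^sub>p\<close>.\<close>

definition saturation :: "'a::idom set \<Rightarrow> 'a set \<Rightarrow> 'a set"
  where "saturation p J = {f. to_fract f \<in> Idl\<^bsub>localization p\<^esub> (to_fract ` J)}"

text \<open>\<open>Ass I\<close> is taken to be \<open>Ass (R/I)\<close>: the primes that are annihilators of elements of \<open>R/I\<close>.\<close>

definition associated_primes :: "'a::comm_ring_1 set \<Rightarrow> 'a set set"
  where "associated_primes I =
    {p. primeideal p ring_of_type_algebra \<and> (\<exists>f. p = {r. r * f \<in> I})}"

definition symbolic_power :: "'a::idom set \<Rightarrow> nat \<Rightarrow> 'a set"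
  where "symbolic_power I s = (\<Inter>p\<in>associated_primes I. saturation p (I [^]\<^bsub>ideals\<^esub> s))"

text \<open>
  The vertices of a graph are the elements of a finite type \<open>'v\<close>, and a graph is given by its set
  \<open>E\<close> of edges, each a two-element set. The polynomial ring over \<open>'k\<close> whose variables are the
  vertices is \<open>('v \<Rightarrow>\<^sub>0 nat) \<Rightarrow>\<^sub>0 'k\<close>; the order on \<open>'v\<close> is required only because the library needs
  it to know that this ring is a domain.
\<close>

definition complete_graph :: "'v set set"
  where "complete_graph = {{u, v} | u v. u \<noteq> v}"

definition vertex_cover :: "'v set set \<Rightarrow> 'v set \<Rightarrow> bool"
  where "vertex_cover E V \<longleftrightarrow> (\<forall>e\<in>E. V \<inter> e \<noteq> {})"

definition minimal_vertex_cover :: "'v set set \<Rightarrow> 'v set \<Rightarrow> bool"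
  where "minimal_vertex_cover E V \<longleftrightarrow> vertex_cover E V \<and> (\<forall>U. U \<subset> V \<longrightarrow> \<not> vertex_cover E U)"

definition monomial :: "('v \<Rightarrow>\<^sub>0 nat) \<Rightarrow> (('v \<Rightarrow>\<^sub>0 nat) \<Rightarrow>\<^sub>0 'k::field)"
  where "monomial a = Poly_Mapping.single a 1"

definition var :: "'v \<Rightarrow> (('v \<Rightarrow>\<^sub>0 nat) \<Rightarrow>\<^sub>0 'k::field)"
  where "var v = monomial (Poly_Mapping.single v 1)"

definition edge_ideal :: "'v set set \<Rightarrow> (('v \<Rightarrow>\<^sub>0 nat) \<Rightarrow>\<^sub>0 'k::field) set"
  where "edge_ideal E = Idl\<^bsub>ring_of_type_algebra\<^esub> {var u * var v | u v. {u, v} \<in> E}"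

text \<open>\<open>W\<^sub>V(M)\<close> for the monomial \<open>M\<close> with exponents \<open>a\<close>; for \<open>V = UNIV\<close> this is the degree of \<open>M\<close>.\<close>

definition weight :: "'v::finite set \<Rightarrow> ('v \<Rightarrow>\<^sub>0 nat) \<Rightarrow> nat"
  where "weight V a = (\<Sum>v\<in>V. Poly_Mapping.lookup a v)"

definition D :: "'v::finite set set \<Rightarrow> nat \<Rightarrow> (('v \<Rightarrow>\<^sub>0 nat) \<Rightarrow>\<^sub>0 'k::field) set"
  where "D E t = {monomial a | a.
    weight UNIV a < 2 * t \<and> (\<forall>V. minimal_vertex_cover E V \<longrightarrow> weight V a \<ge> t)}"

end

theory Submission
  imports Defs "HOL-Library.Set_Algebras"
begin

text \<open>
  Every ideal involved is a monomial ideal, and \<open>A \<mapsto> monomial_ideal A\<close> turns unions and sumsets of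
  exponent sets into sums and products of ideals, so both identities reduce to statements about
  exponents. Let \<open>Q\<^sub>s\<close> be the set of exponents of weight at least \<open>s\<close> on every minimal vertex cover,
  that is, on every complement of a vertex. The ideal of \<open>Q\<^sub>s\<close> is \<open>I\<^sup>(\<^sup>s\<^sup>)\<close>: one inclusion holds because
  the powers of the cover primes are primary; for the other, an associated prime of \<open>I\<close> omits some
  variable \<open>x\<close>, and \<open>x\<^sup>s\<close> multiplies the ideal of \<open>Q\<^sub>s\<close> into \<open>I\<^sup>s\<close>.

  An element of \<open>Q\<^sub>s\<close> of degree at least \<open>2s\<close> dominates a sum of \<open>s\<close> edges, which gives the first
  identity. The second one follows by repeatedly splitting off the indicator of the support, which
  lies in \<open>Q\<^sub>k\<close> with \<open>k + 1\<close> the size of the support and leaves an element of \<open>Q\<^sub>s\<^sub>-\<^sub>k\<close>.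
\<close>

section \<open>Ideals of a ring given by a type\<close>

lemma ring_of_type_algebra_simps [simp]:
  "carrier ring_of_type_algebra = (UNIV :: 'a::comm_ring_1 set)"
  "monoid.mult ring_of_type_algebra = ((*) :: 'a \<Rightarrow> 'a \<Rightarrow> 'a)"
  "monoid.one ring_of_type_algebra = (1 :: 'a)"
  "ring.zero ring_of_type_algebra = (0 :: 'a)"
  "ring.add ring_of_type_algebra = ((+) :: 'a \<Rightarrow> 'a \<Rightarrow> 'a)"
  by (simp_all add: ring_of_type_algebra_def)

lemma a_inv_ring_of_type_algebra [simp]:
  "\<ominus>\<^bsub>ring_of_type_algebra\<^esub> (x :: 'a::comm_ring_1) = - x"
proof -
  interpret ring "ring_of_type_algebra :: 'a ring" by (rule ring_from_type_algebra)
  show ?thesis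
    using minus_equality[of "- x" x] by simp
qed

lemma ideal_of_type_algebraI:
  fixes J :: "'a::comm_ring_1 set"
  assumes "0 \<in> J" "\<And>x y. x \<in> J \<Longrightarrow> y \<in> J \<Longrightarrow> x + y \<in> J" "\<And>x r. x \<in> J \<Longrightarrow> r * x \<in> J"
  shows "ideal J ring_of_type_algebra"
proof -
  interpret ring "ring_of_type_algebra :: 'a ring" by (rule ring_from_type_algebra)
  have "- x \<in> J" if "x \<in> J" for x
    using assms(3)[OF that, of "- 1"] by simp
  then have "subgroup J (add_monoid ring_of_type_algebra)"
    using assms(1,2) by (intro add.subgroupI) (auto simp flip: a_inv_def)
  then show ?thesis
    using assms(3) by (intro idealI ring_from_type_algebra) (auto simp: mult.commute)
qed

context
  fixes J :: "'a::comm_ring_1 set"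
  assumes J: "ideal J ring_of_type_algebra"
begin

interpretation ideal J ring_of_type_algebra by (rule J)

lemma ideal_of_type_algebra_zero: "0 \<in> J"
  using additive_subgroup.zero_closed[OF is_additive_subgroup] by simp

lemma ideal_of_type_algebra_add: "x \<in> J \<Longrightarrow> y \<in> J \<Longrightarrow> x + y \<in> J"
  using additive_subgroup.a_closed[OF is_additive_subgroup] by simp

lemma ideal_of_type_algebra_mult: "x \<in> J \<Longrightarrow> r * x \<in> J"
  using I_l_closed by simp

lemma ideal_of_type_algebra_sum:
  "(\<And>i. i \<in> A \<Longrightarrow> f i \<in> J) \<Longrightarrow> (\<Sum>i\<in>A. f i) \<in> J"
  by (induction A rule: infinite_finite_induct)
    (auto intro: ideal_of_type_algebra_zero ideal_of_type_algebra_add)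

end

lemma primeideal_of_type_algebra:
  fixes p :: "'a::comm_ring_1 set"
  assumes "primeideal p ring_of_type_algebra"
  shows "0 \<in> p" "1 \<notin> p" "x * y \<in> p \<Longrightarrow> x \<in> p \<or> y \<in> p"
proof -
  interpret primeideal p ring_of_type_algebra by (rule assms)
  show "0 \<in> p" by (rule ideal_of_type_algebra_zero[OF is_ideal])
  show "1 \<notin> p" using I_notcarr one_imp_carrier by auto
  show "x * y \<in> p \<Longrightarrow> x \<in> p \<or> y \<in> p" using I_prime by auto
qed

lemma comm_monoid_ideals: "comm_monoid (ideals :: 'a::comm_ring_1 set ring)"
  by (intro cring.ideals_set_is_comm_monoid cring_from_type_algebra)

lemma abelian_monoid_ideals: "abelian_monoid (ideals :: 'a::comm_ring_1 set ring)"
proof -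
  interpret semiring "ideals :: 'a set ring"
    by (intro cring.ideals_set_is_semiring cring_from_type_algebra)
  show ?thesis by unfold_locales
qed


section \<open>Saturation at a prime\<close>

text \<open>The complement of a prime is closed under products, so it supplies the denominators of
  sums and products; \<open>0 \<in> p\<close> keeps them nonzero, as the rules for
  \<open>Fract\<close> require.\<close>

lemma ring_localization:
  fixes p :: "'a::idom set"
  assumes p: "primeideal p ring_of_type_algebra"
  shows "ring (localization p)"
  unfolding localization_def
proof (rule ring.subring_is_ring[OF ring_from_type_algebra], rule ring.subringI[OF ring_from_type_algebra])
  note prime = primeideal_of_type_algebra[OF p]
  have nz: "b \<noteq> 0" if "b \<notin> p" for b
    using that prime(1) by auto
  let ?C = "{Fract a b | a b. b \<notin> p}"
  show "\<one>\<^bsub>ring_of_type_algebra\<^esub> \<in> ?C"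
    using prime(2) by (auto simp: One_fract_def)
  fix h assume "h \<in> ?C"
  then obtain a b where ab: "h = Fract a b" "b \<notin> p" by auto
  then show "\<ominus>\<^bsub>ring_of_type_algebra\<^esub> h \<in> ?C" by auto
  fix k assume "k \<in> ?C"
  then obtain c d where cd: "k = Fract c d" "d \<notin> p" by auto
  have "b * d \<notin> p" using ab(2) cd(2) prime(3) by auto
  with ab cd nz show "h \<otimes>\<^bsub>ring_of_type_algebra\<^esub> k \<in> ?C" "h \<oplus>\<^bsub>ring_of_type_algebra\<^esub> k \<in> ?C"
    by (auto simp: mult_fract add_fract)
qed simp

text \<open>Clears denominators, so that later arguments stay in the polynomial ring: the fractions
  with numerator in \<open>J\<close> form an ideal of the localization that contains the image of
  \<open>J\<close>.\<close>

lemma saturation_iff: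
  fixes p J :: "'a::idom set"
  assumes p: "primeideal p ring_of_type_algebra" and J: "ideal J ring_of_type_algebra"
  shows "f \<in> saturation p J \<longleftrightarrow> (\<exists>b. b \<notin> p \<and> b * f \<in> J)"
proof
  note prime = primeideal_of_type_algebra[OF p]
  have nz: "b \<noteq> 0" if "b \<notin> p" for b
    using that prime(1) by auto
  let ?K = "{Fract a b | a b. a \<in> J \<and> b \<notin> p}"
  interpret loc: ring "localization p" by (rule ring_localization[OF p])
  have carrier: "carrier (localization p) = {Fract a b | a b. b \<notin> p}"
    and mult: "monoid.mult (localization p) = (*)" and add: "ring.add (localization p) = (+)"
    and zero: "ring.zero (localization p) = 0"
    by (simp_all add: localization_def)
  have K_mult: "x * y \<in> ?K" if xy: "x \<in> ?K" "y \<in> carrier (localization p)" for x y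
  proof -
    obtain a b c d where *: "x = Fract a b" "a \<in> J" "b \<notin> p" "y = Fract c d" "d \<notin> p"
      using xy by (auto simp: carrier)
    then have "b * d \<notin> p" using prime(3) by auto
    moreover have "a * c \<in> J"
      using ideal_of_type_algebra_mult[OF J *(2), of c] by (simp add: mult.commute)
    ultimately show ?thesis using * nz by (auto simp: mult_fract)
  qed
  have "ideal ?K (localization p)"
  proof (rule idealI[OF loc.ring_axioms])
    show "subgroup ?K (add_monoid (localization p))"
    proof (rule loc.add.subgroupI)
      show "?K \<subseteq> carrier (localization p)" by (auto simp: carrier)
      show "?K \<noteq> {}"
        using prime(2) ideal_of_type_algebra_zero[OF J] by auto
      fix x assume x: "x \<in> ?K"
      have "- 1 \<in> carrier (localization p)"
        using prime(2) by (auto simp: carrier One_fract_def)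
      then have minus: "- x \<in> ?K"
        using K_mult[OF x, of "- 1"] by simp
      moreover have "\<ominus>\<^bsub>localization p\<^esub> x = - x"
        using x minus by (intro loc.minus_equality) (auto simp: add zero carrier)
      ultimately show "\<ominus>\<^bsub>localization p\<^esub> x \<in> ?K" by simp
      fix y assume y: "y \<in> ?K"
      obtain a b c d where *: "x = Fract a b" "a \<in> J" "b \<notin> p" "y = Fract c d" "c \<in> J" "d \<notin> p"
        using x y by auto
      then have "b * d \<notin> p" using prime(3) by auto
      moreover have "a * d + c * b \<in> J"
        using ideal_of_type_algebra_add[OF J] ideal_of_type_algebra_mult[OF J] *
        by (metis mult.commute)
      ultimately show "x \<oplus>\<^bsub>localization p\<^esub> y \<in> ?K"
        using * nz by (auto simp: add add_fract)
    qed
  qed (use K_mult in \<open>auto simp: mult mult.commute\<close>)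
  moreover have "to_fract ` J \<subseteq> ?K"
    using prime(2) by (auto simp: to_fract_def)
  moreover assume "f \<in> saturation p J"
  ultimately have "to_fract f \<in> ?K"
    by (auto simp: saturation_def genideal_def)
  then obtain a b where ab: "to_fract f = Fract a b" "a \<in> J" "b \<notin> p" by auto
  then have "b * f = a" using nz[of b] by (simp add: to_fract_def eq_fract mult.commute)
  with ab show "\<exists>b. b \<notin> p \<and> b * f \<in> J" by auto
next
  note prime = primeideal_of_type_algebra[OF p]
  assume "\<exists>b. b \<notin> p \<and> b * f \<in> J"
  then obtain b where b: "b \<notin> p" "b * f \<in> J" by auto
  then have nz: "b \<noteq> 0" using prime(1) by auto
  \<comment> \<open>The fraction \<open>1 / b\<close> lies in the localization and carries
    \<open>b * f\<close> back to \<open>f\<close>.\<close>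
  have "to_fract f \<in> K" if K: "ideal K (localization p)" "to_fract ` J \<subseteq> K" for K
  proof -
    have "to_fract (b * f) \<in> K" using K b by auto
    moreover have "Fract 1 b \<in> carrier (localization p)" using b by (auto simp: localization_def)
    ultimately have "Fract 1 b * to_fract (b * f) \<in> K"
      using ideal.I_l_closed[OF K(1)] by (force simp: localization_def)
    moreover have "Fract 1 b * to_fract (b * f) = to_fract f"
      using nz by (auto simp: to_fract_def eq_fract)
    ultimately show ?thesis by metis
  qed
  then show "f \<in> saturation p J" by (auto simp: saturation_def genideal_def)
qed


section \<open>Monomial ideals\<close>

lemma single_lookup_decomposition:
  "(\<Sum>a\<in>Poly_Mapping.keys f. Poly_Mapping.single a (Poly_Mapping.lookup f a)) = f"
  by (rule poly_mapping_eqI) (auto simp: lookup_sum lookup_single when_def in_keys_iff)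

text \<open>For exponents, \<open>A + UNIV\<close> is the closure of \<open>A\<close> under
  multiples of monomials, so membership is tested term by term. \<open>genideal_monomials\<close>
  identifies this with the generated ideal.\<close>

definition monomial_ideal ::
    "('v \<Rightarrow>\<^sub>0 nat) set \<Rightarrow> (('v \<Rightarrow>\<^sub>0 nat) \<Rightarrow>\<^sub>0 'k::field) set"
  where "monomial_ideal A = {f. Poly_Mapping.keys f \<subseteq> A + UNIV}"

lemma monomial_mult: "monomial a * monomial b = monomial (a + b)"
  by (simp add: monomial_def mult_single)

lemma keys_monomial [simp]: "Poly_Mapping.keys (monomial a :: _ \<Rightarrow>\<^sub>0 'k::field) = {a}"
  by (simp add: monomial_def)

lemma plus_UNIV_upward: "a \<in> A + UNIV \<Longrightarrow> a + b \<in> A + (UNIV :: 'a::semigroup_add set)"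
  by (metis UNIV_I add.assoc set_plus_elim set_plus_intro)

lemma plus_UNIV_superset: "A \<subseteq> A + (UNIV :: 'a::monoid_add set)"
  using set_plus_intro[of _ A 0 UNIV] by auto

lemma ideal_monomial_ideal [simp]: "ideal (monomial_ideal A) ring_of_type_algebra"
proof (rule ideal_of_type_algebraI; unfold monomial_ideal_def mem_Collect_eq)
  fix x r :: "('a \<Rightarrow>\<^sub>0 nat) \<Rightarrow>\<^sub>0 'b"
  assume "Poly_Mapping.keys x \<subseteq> A + UNIV"
  then show "Poly_Mapping.keys (r * x) \<subseteq> A + UNIV"
    using keys_mult[of r x] plus_UNIV_upward[of _ A] by (fastforce simp: add.commute)
qed (use Poly_Mapping.keys_add in \<open>fastforce+\<close>)

lemma monomial_in_monomial_ideal: "a \<in> A \<Longrightarrow> monomial a \<in> monomial_ideal A"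
  using plus_UNIV_superset[of A] by (auto simp: monomial_ideal_def)

lemma monomial_ideal_least:
  fixes J :: "(('v \<Rightarrow>\<^sub>0 nat) \<Rightarrow>\<^sub>0 'k::field) set"
  assumes J: "ideal J ring_of_type_algebra" and A: "\<And>a. a \<in> A \<Longrightarrow> monomial a \<in> J"
  shows "monomial_ideal A \<subseteq> J"
proof
  fix f :: "('v \<Rightarrow>\<^sub>0 nat) \<Rightarrow>\<^sub>0 'k" assume f: "f \<in> monomial_ideal A"
  have "Poly_Mapping.single c (Poly_Mapping.lookup f c) \<in> J" if c: "c \<in> Poly_Mapping.keys f" for c
  proof -
    obtain a b where ab: "c = b + a" "a \<in> A"
      using f c by (auto simp: monomial_ideal_def set_plus_def add.commute)
    have "Poly_Mapping.single b (Poly_Mapping.lookup f c) * monomial a = Poly_Mapping.single c (Poly_Mapping.lookup f c)"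
      by (simp add: monomial_def mult_single ab)
    then show ?thesis
      using ideal_of_type_algebra_mult[OF J A[OF ab(2)]] by metis
  qed
  then have "(\<Sum>c\<in>Poly_Mapping.keys f. Poly_Mapping.single c (Poly_Mapping.lookup f c)) \<in> J"
    by (rule ideal_of_type_algebra_sum[OF J])
  then show "f \<in> J" by (simp add: single_lookup_decomposition)
qed

lemma monomial_ideal_mono: "A \<subseteq> B + UNIV \<Longrightarrow> monomial_ideal A \<subseteq> monomial_ideal B"
  by (rule monomial_ideal_least[OF ideal_monomial_ideal]) (auto simp: monomial_ideal_def)

lemma genideal_monomials: "Idl\<^bsub>ring_of_type_algebra\<^esub> (monomial ` A) = monomial_ideal A"
proof
  show "Idl\<^bsub>ring_of_type_algebra\<^esub> (monomial ` A) \<subseteq> monomial_ideal A"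
    using monomial_in_monomial_ideal ideal_monomial_ideal unfolding genideal_def by blast
  show "monomial_ideal A \<subseteq> Idl\<^bsub>ring_of_type_algebra\<^esub> (monomial ` A)"
    unfolding genideal_def using monomial_ideal_least by blast
qed

section \<open>Sums, products and powers of monomial ideals\<close>

lemma monomial_ideal_in_ideals [simp]: "monomial_ideal A \<in> carrier ideals"
  by (simp add: ideals_set_def)

lemma zero_ideals: "\<zero>\<^bsub>ideals\<^esub> = monomial_ideal {}"
  by (auto simp: ideals_set_def monomial_ideal_def)

lemma one_ideals: "\<one>\<^bsub>ideals\<^esub> = monomial_ideal {0}"
proof -
  have "{0} + (UNIV :: ('a \<Rightarrow>\<^sub>0 nat) set) = UNIV"
    by (metis set_zero add_0)
  then show ?thesis by (auto simp: ideals_set_def monomial_ideal_def)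
qed

text \<open>Exponents of a product are sums of exponents of the factors, which bounds the product
  from above; conversely, each generator on the right is a product of two generators.\<close>

lemma mult_ideals:
  "monomial_ideal A \<otimes>\<^bsub>ideals\<^esub> monomial_ideal B = monomial_ideal (A + B)"
proof -
  let ?AB = "ideal_prod ring_of_type_algebra (monomial_ideal A) (monomial_ideal B)"
  have "f \<in> monomial_ideal (A + B)" if "f \<in> ?AB" for f
    using that
  proof induction
    case (prod f g)
    have "a + b \<in> A + B + UNIV" if "a \<in> A + UNIV" "b \<in> B + UNIV" for a b
    proof -
      obtain a1 a2 b1 b2 where "a = a1 + a2" "a1 \<in> A" "b = b1 + b2" "b1 \<in> B"
        using \<open>a \<in> A + UNIV\<close> \<open>b \<in> B + UNIV\<close> by (auto simp: set_plus_def)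
      moreover have "(a1 + a2) + (b1 + b2) = (a1 + b1) + (a2 + b2)"
        by (simp add: ac_simps)
      ultimately show ?thesis by (metis UNIV_I set_plus_intro)
    qed
    then show ?case
      using prod keys_mult[of f g] by (fastforce simp: monomial_ideal_def)
  qed (use ideal_of_type_algebra_add[OF ideal_monomial_ideal] in auto)
  moreover have "monomial_ideal (A + B) \<subseteq> ?AB"
  proof (rule monomial_ideal_least)
    show "ideal ?AB ring_of_type_algebra"
      by (intro ring.ideal_prod_is_ideal ring_from_type_algebra) auto
    fix c assume "c \<in> A + B"
    then obtain a b where "a \<in> A" "b \<in> B" "c = a + b" by (auto simp: set_plus_def)
    then show "monomial c \<in> ?AB"
      using ideal_prod.prod[OF monomial_in_monomial_ideal monomial_in_monomial_ideal,
          of a A b B ring_of_type_algebra]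
      by (simp add: monomial_mult)
  qed
  ultimately show ?thesis by (auto simp: ideals_set_def)
qed

lemma add_ideals:
  "monomial_ideal A \<oplus>\<^bsub>ideals\<^esub> monomial_ideal B = monomial_ideal (A \<union> B)"
proof -
  have set_add: "C <+>\<^bsub>ring_of_type_algebra\<^esub> E = {x + y | x y. x \<in> C \<and> y \<in> E}"
    for C E :: "(('a \<Rightarrow>\<^sub>0 nat) \<Rightarrow>\<^sub>0 'b) set"
    by (auto simp: set_add_def set_mult_def)
  let ?S = "monomial_ideal A <+>\<^bsub>ring_of_type_algebra\<^esub> monomial_ideal B :: (('a \<Rightarrow>\<^sub>0 nat) \<Rightarrow>\<^sub>0 'b) set"
  have "monomial_ideal (A \<union> B) \<subseteq> ?S"
  proof (rule monomial_ideal_least)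
    show "ideal ?S ring_of_type_algebra"
      by (intro ring.add_ideals ring_from_type_algebra) auto
    have zero: "0 \<in> monomial_ideal C" for C :: "('a \<Rightarrow>\<^sub>0 nat) set"
      by (simp add: monomial_ideal_def)
    fix c assume "c \<in> A \<union> B"
    then show "monomial c \<in> ?S"
      unfolding set_add using monomial_in_monomial_ideal zero
      by (metis (mono_tags, lifting) Un_iff add.left_neutral add.right_neutral mem_Collect_eq)
  qed
  moreover have "?S \<subseteq> monomial_ideal (A \<union> B)"
    using ideal_of_type_algebra_add[OF ideal_monomial_ideal, of _ "A \<union> B"]
      monomial_ideal_mono[of A "A \<union> B"] monomial_ideal_mono[of B "A \<union> B"]
      plus_UNIV_superset[of "A \<union> B"]
    unfolding set_add by blast
  ultimately show ?thesis by (auto simp: ideals_set_def)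
qed

text \<open>The constant sum is the \<open>s\<close>-fold sumset of \<open>A\<close>; for
  \<open>s = 0\<close> it is \<open>{0}\<close>, which matches the unit ideal.\<close>

lemma pow_ideals: "monomial_ideal A [^]\<^bsub>ideals\<^esub> (s::nat) = monomial_ideal (\<Sum>i<s. A)"
proof -
  interpret comm_monoid "ideals :: (('a \<Rightarrow>\<^sub>0 nat) \<Rightarrow>\<^sub>0 'b) set ring"
    by (rule comm_monoid_ideals)
  show ?thesis
    by (induction s) (simp_all add: one_ideals mult_ideals add.commute)
qed

lemma finprod_ideals:
  assumes "finite S"
  shows "(\<Otimes>\<^bsub>ideals\<^esub>i\<in>S. monomial_ideal (A i)) = monomial_ideal (\<Sum>i\<in>S. A i)"
proof -
  interpret comm_monoid "ideals :: (('b \<Rightarrow>\<^sub>0 nat) \<Rightarrow>\<^sub>0 'c) set ring"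
    by (rule comm_monoid_ideals)
  show ?thesis
    using assms by (induction S) (simp_all add: one_ideals mult_ideals)
qed

lemma finsum_ideals:
  assumes "finite S"
  shows "(\<Oplus>\<^bsub>ideals\<^esub>i\<in>S. monomial_ideal (A i)) = monomial_ideal (\<Union>i\<in>S. A i)"
proof -
  interpret abelian_monoid "ideals :: (('b \<Rightarrow>\<^sub>0 nat) \<Rightarrow>\<^sub>0 'c) set ring"
    by (rule abelian_monoid_ideals)
  show ?thesis
    using assms by (induction S) (simp_all add: zero_ideals add_ideals)
qed

section \<open>Exponents of weight at least \<open>s\<close> on all covers\<close>

lemma weight_add: "weight V (a + b) = weight V a + weight V b"
  by (simp add: weight_def lookup_add sum.distrib)

lemma weight_single: "weight V (Poly_Mapping.single v k) = (if v \<in> V then k else 0)"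
  by (simp add: weight_def lookup_single when_def sum.delta)

lemma weight_UNIV: "weight UNIV a = Poly_Mapping.lookup a v + weight (- {v}) a"
  by (simp add: weight_def sum.remove[of UNIV v] Compl_eq_Diff_UNIV)

lemma weight_mono: "U \<subseteq> V \<Longrightarrow> weight U a \<le> weight V a"
  by (simp add: weight_def sum_mono2)

text \<open>For the complete graph the sets \<open>- {v}\<close> are exactly the minimal vertex
  covers (\<open>minimal_vertex_cover_complete_graph\<close>).\<close>

definition cover_exponents :: "nat \<Rightarrow> ('v::finite \<Rightarrow>\<^sub>0 nat) set"
  where "cover_exponents s = {a. \<forall>v. s \<le> weight (- {v}) a}"

definition edge_exponents :: "('v \<Rightarrow>\<^sub>0 nat) set"
  where "edge_exponents =
    {Poly_Mapping.single u 1 + Poly_Mapping.single v 1 | u v. u \<noteq> v}"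

lemma cover_exponents_add:
  "a \<in> cover_exponents s \<Longrightarrow> b \<in> cover_exponents t \<Longrightarrow> a + b \<in> cover_exponents (s + t)"
  by (simp add: cover_exponents_def weight_add add_mono)

lemma cover_exponents_plus: "cover_exponents s + cover_exponents t \<subseteq> cover_exponents (s + t)"
  by (auto simp: cover_exponents_add elim!: set_plus_elim)

lemma cover_exponents_0 [simp]: "cover_exponents 0 = UNIV"
  by (simp add: cover_exponents_def)

text \<open>Adding \<open>UNIV\<close> is adding \<open>cover_exponents 0\<close>. Hence the ideal
  of \<open>cover_exponents s\<close> consists of the polynomials with all exponents in that very
  set.\<close>

lemma cover_exponents_upward [simp]: "cover_exponents s + UNIV = cover_exponents s"
  using cover_exponents_plus[of s 0] plus_UNIV_superset[of "cover_exponents s"] by auto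

lemma sum_cover_exponents:
  "(\<Sum>i\<in>S. cover_exponents (t i)) \<subseteq> cover_exponents (\<Sum>i\<in>S. t i)"
proof (induction S rule: infinite_finite_induct)
  case (insert i S)
  then show ?case
    using subset_trans[OF set_plus_mono2[OF subset_refl insert.IH] cover_exponents_plus] by simp
qed auto

lemma edge_exponents_subset: "edge_exponents \<subseteq> cover_exponents 1"
  by (auto simp: edge_exponents_def cover_exponents_def weight_add weight_single)

text \<open>Greedy matching: removing an edge between two vertices of largest exponent preserves the hypotheses.\<close>

lemma edge_sum_if_large_degree:
  fixes a :: "'v::finite \<Rightarrow>\<^sub>0 nat"
  assumes "a \<in> cover_exponents s" "2 * s \<le> weight UNIV a"
  shows "a \<in> (\<Sum>i<s. edge_exponents) + UNIV"
  using assms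
proof (induction s arbitrary: a)
  case 0
  then show ?case using set_plus_intro[of 0 "{0}" a UNIV] by simp
next
  case (Suc s)
  let ?l = "Poly_Mapping.lookup a"
  have max: "\<exists>u\<in>S. \<forall>w\<in>S. ?l w \<le> ?l u" if "S \<noteq> {}" for S
  proof -
    have "Max (?l ` S) \<in> ?l ` S" using that by (intro Max_in) auto
    then obtain u where "u \<in> S" "?l u = Max (?l ` S)" by auto
    then show ?thesis by (metis Max_ge finite finite_imageI imageI)
  qed
  obtain u where u: "?l w \<le> ?l u" for w
    using max[of UNIV] by auto
  have pos: "0 < weight (- {u}) a"
    using Suc.prems(1) by (auto simp: cover_exponents_def Suc_le_eq intro: less_le_trans[of 0 "Suc s"])
  then have "- {u} \<noteq> {}" by (auto simp: weight_def)
  from max[OF this] obtain v where v: "v \<noteq> u" "\<And>w. w \<noteq> u \<Longrightarrow> ?l w \<le> ?l v"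
    by auto
  \<comment> \<open>Otherwise all of \<open>a\<close> would sit on \<open>u\<close>, and the cover
    \<open>- {u}\<close> would have weight 0. So both exponents are positive, and the truncated
    difference \<open>a - e\<close> below is exact.\<close>
  have "0 < ?l v"
  proof (rule ccontr)
    assume "\<not> 0 < ?l v"
    then have "weight (- {u}) a = 0" using v(2) by (force simp: weight_def)
    then show False using pos by simp
  qed
  define e where "e = Poly_Mapping.single u 1 + Poly_Mapping.single v (1::nat)"
  define b where "b = a - e"
  have a: "a = b + e"
    using \<open>0 < ?l v\<close> u[of v] v(1) unfolding b_def e_def
    by (intro poly_mapping_eqI) (auto simp: lookup_add lookup_minus lookup_single when_def)
  have "s \<le> weight (- {w}) b" for w
  proof (cases "w = u \<or> w = v")
    case True
    then have "weight (- {w}) e = 1" using v(1) by (auto simp: e_def weight_add weight_single)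
    moreover have "Suc s \<le> weight (- {w}) a" using Suc.prems(1) by (simp add: cover_exponents_def)
    ultimately show ?thesis by (simp add: a weight_add)
  next
    case False
    then have "weight (- {w}) e = 2" by (auto simp: e_def weight_add weight_single)
    moreover have "weight {u, v} a \<le> weight (- {w}) a" using False by (intro weight_mono) auto
    then have "?l u + ?l v \<le> weight (- {w}) a" using v(1) by (simp add: weight_def)
    \<comment> \<open>The edge costs 2 on such a cover. If \<open>?l w \<le> s\<close>, the degree,
      at least \<open>2 * (s + 1)\<close>, leaves \<open>s + 2\<close> outside \<open>w\<close>;
      otherwise \<open>u\<close> and \<open>v\<close> contribute at least \<open>s + 1\<close>
      each.\<close>
    then have "s + 2 \<le> weight (- {w}) a"
      using u[of w] v(2)[of w] False Suc.prems(2) weight_UNIV[of a w] by (cases "?l w \<le> s") auto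
    ultimately show ?thesis by (simp add: a weight_add)
  qed
  moreover have "2 * s \<le> weight UNIV b"
    using Suc.prems(2) by (simp add: a e_def weight_add weight_single)
  ultimately have "b \<in> (\<Sum>i<s. edge_exponents) + UNIV"
    by (intro Suc.IH) (auto simp: cover_exponents_def)
  then obtain x y where "b = x + y" "x \<in> (\<Sum>i<s. edge_exponents)" by (auto simp: set_plus_def)
  moreover have "e \<in> edge_exponents" using v(1) by (auto simp: edge_exponents_def e_def)
  ultimately have "x + e \<in> (\<Sum>i<Suc s. edge_exponents)" "a = (x + e) + y"
    by (auto simp: a ac_simps)
  then show ?case by (metis UNIV_I set_plus_intro)
qed

lemma sum_edge_exponents_subset: "(\<Sum>i<s. edge_exponents) \<subseteq> cover_exponents s"
proof (induction s)
  case (Suc s)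
  then show ?case
    using subset_trans[OF set_plus_mono2[OF Suc.IH edge_exponents_subset] cover_exponents_plus]
    by (simp add: add.commute)
qed simp

text \<open>For \<open>s = 1\<close> the degree bound of the greedy matching is automatic: some
  vertex \<open>u\<close> has a positive exponent, and the cover \<open>- {u}\<close> adds at least
  1.\<close>

lemma edge_exponents_upward: "edge_exponents + UNIV = (cover_exponents 1 :: ('v::finite \<Rightarrow>\<^sub>0 nat) set)"
proof
  show "edge_exponents + UNIV \<subseteq> (cover_exponents 1 :: ('v \<Rightarrow>\<^sub>0 nat) set)"
    using set_plus_mono2[OF edge_exponents_subset subset_refl, of UNIV] by simp
  show "(cover_exponents 1 :: ('v \<Rightarrow>\<^sub>0 nat) set) \<subseteq> edge_exponents + UNIV"
  proof
    fix a :: "'v \<Rightarrow>\<^sub>0 nat" assume a: "a \<in> cover_exponents 1"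
    \<comment> \<open>Here \<open>undefined\<close> stands for an arbitrary vertex.\<close>
    then have "1 \<le> weight (- {undefined}) a" by (simp add: cover_exponents_def)
    then obtain u where u: "0 < Poly_Mapping.lookup a u"
      by (metis (no_types, lifting) weight_def bot_nat_0.not_eq_extremum not_one_le_zero sum.neutral)
    moreover have "1 \<le> weight (- {u}) a" using a by (simp add: cover_exponents_def)
    ultimately have "2 * 1 \<le> weight UNIV a" using weight_UNIV[of a u] by simp
    from edge_sum_if_large_degree[OF a this] show "a \<in> edge_exponents + UNIV" by simp
  qed
qed

text \<open>The indicator of the support, of size \<open>m\<close>, has weight at least \<open>m - 1\<close> on every cover, and
  removing it from \<open>a\<close> costs at most \<open>m - 1\<close>: on the covers that contain the support
  the weight of \<open>a\<close> is its degree, hence at least \<open>s + 1\<close>.\<close>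

lemma cover_exponents_split:
  fixes a :: "'v::finite \<Rightarrow>\<^sub>0 nat"
  assumes a: "a \<in> cover_exponents s" and s: "0 < s"
  obtains k b c where "a = b + c" "0 < k" "k < card (UNIV :: 'v set)"
    "b \<in> cover_exponents k" "c \<in> cover_exponents (s - k)"
proof -
  let ?l = "Poly_Mapping.lookup a"
  let ?A = "{v. 0 < ?l v}"
  define b where "b = Abs_poly_mapping (\<lambda>v. if v \<in> ?A then 1 else 0 :: nat)"
  define c where "c = a - b"
  define k where "k = card ?A - 1"
  have lookup_b: "Poly_Mapping.lookup b v = (if v \<in> ?A then 1 else 0)" for v
    unfolding b_def by (subst lookup_Abs_poly_mapping) auto
  have weight_b: "weight V b = card (V \<inter> ?A)" for V
    by (simp add: weight_def lookup_b sum.If_cases Int_def)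
  have a_eq: "a = b + c"
    unfolding c_def by (rule poly_mapping_eqI) (auto simp: lookup_add lookup_minus lookup_b)
  have weight_a: "s \<le> weight (- {v}) a" for v using a by (simp add: cover_exponents_def)
  \<comment> \<open>Every cover \<open>- {v}\<close> has positive weight, so the support is not
    contained in a single vertex. Two vertices in it give \<open>0 < k\<close>.\<close>
  have other: "\<exists>u\<in>?A. u \<noteq> v" for v
  proof -
    have "weight (- {v}) a \<noteq> 0" using weight_a[of v] s by linarith
    then show ?thesis by (auto simp: weight_def)
  qed
  then obtain u v where uv: "u \<in> ?A" "v \<in> ?A" "u \<noteq> v" by blast
  then have "card {u, v} \<le> card ?A" by (intro card_mono) auto
  then have card_A: "card ?A = Suc k" "0 < k" using uv(3) by (auto simp: k_def)
  have "k < card (UNIV :: 'v set)" using card_mono[of UNIV ?A] card_A by simp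
  moreover have card_diff: "card (- {w} \<inter> ?A) = (if w \<in> ?A then k else Suc k)" for w
  proof -
    have "- {w} \<inter> ?A = ?A - {w}" by auto
    then show ?thesis using card_A(1) by (simp add: card_Diff_singleton_if)
  qed
  then have "b \<in> cover_exponents k" by (auto simp: cover_exponents_def weight_b)
  moreover have "s - k \<le> weight (- {w}) c" for w
  proof -
    have "weight (- {w}) a = card (- {w} \<inter> ?A) + weight (- {w}) c"
      by (subst a_eq) (simp add: weight_add weight_b)
    \<comment> \<open>The degree of \<open>a\<close> exceeds its weight on \<open>- {u}\<close> by
      the positive exponent of \<open>u\<close>; this pays for the extra unit in
      \<open>Suc k\<close>.\<close>
    moreover have "s < weight (- {w}) a" if "w \<notin> ?A"
      using weight_UNIV[of a w] weight_UNIV[of a u] weight_a[of u] uv(1) that by simp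
    ultimately show ?thesis using weight_a[of w] card_diff[of w] by (auto split: if_splits)
  qed
  then have "c \<in> cover_exponents (s - k)" by (simp add: cover_exponents_def)
  ultimately show thesis using that a_eq card_A(2) by blast
qed

text \<open>Strong induction on \<open>s\<close>, adding one factor of index \<open>k\<close> at a
  time. The functions are extensional so that they match the index set of the sum of ideals.\<close>

lemma cover_exponents_decomposition:
  fixes a :: "'v::finite \<Rightarrow>\<^sub>0 nat"
  assumes "a \<in> cover_exponents s"
  shows "\<exists>r \<in> {1..card (UNIV :: 'v set) - 1} \<rightarrow>\<^sub>E UNIV. s = (\<Sum>i = 1..card (UNIV :: 'v set) - 1. i * r i) \<and>
    a \<in> (\<Sum>i = 1..card (UNIV :: 'v set) - 1. \<Sum>j<r i. cover_exponents i) + UNIV"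
  using assms
proof (induction s arbitrary: a rule: less_induct)
  case (less s)
  let ?S = "{1..card (UNIV :: 'v set) - 1}"
  let ?X = "\<lambda>r. \<Sum>i\<in>?S. \<Sum>j<r i. cover_exponents i :: ('v \<Rightarrow>\<^sub>0 nat) set"
  show ?case
  proof (cases "s = 0")
    case True
    let ?r = "\<lambda>i\<in>?S. 0 :: nat"
    have "?X ?r = 0" by (rule sum.neutral) auto
    then have "a \<in> ?X ?r + UNIV" using set_plus_intro[of 0 "{0}" a UNIV] by simp
    moreover have "s = (\<Sum>i\<in>?S. i * ?r i)" by (simp add: True)
    ultimately show ?thesis by (intro bexI[of _ ?r] conjI) auto
  next
    case False
    obtain k b c where *: "a = b + c" "k \<in> ?S" "k \<le> s" "b \<in> cover_exponents k"
      "c \<in> cover_exponents (s - k)"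
    \<comment> \<open>Below the number of vertices, \<open>a\<close> itself is one factor of index
      \<open>s\<close>. Otherwise the split yields \<open>k\<close> below the number of vertices, so
      \<open>k \<le> s\<close> and \<open>s - k\<close> is a true difference.\<close>
    proof (cases "s < card (UNIV :: 'v set)")
      case True
      then show thesis using that[of a 0 s] less.prems False by auto
    next
      case False
      obtain k b c where "a = b + c" "0 < k" "k < card (UNIV :: 'v set)"
        "b \<in> cover_exponents k" "c \<in> cover_exponents (s - k)"
        using cover_exponents_split[OF less.prems] \<open>s \<noteq> 0\<close> by blast
      with False show thesis by (intro that[of b c k]) auto
    qed
    then have "s - k < s" using False by auto
    from less.IH[OF this *(5)] obtain r where r: "r \<in> ?S \<rightarrow>\<^sub>E UNIV" "s - k = (\<Sum>i\<in>?S. i * r i)"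
      "c \<in> ?X r + UNIV" by auto
    define r' where "r' = r(k := Suc (r k))"
    \<comment> \<open>Generic in \<open>h\<close> because it serves both the sum of the numbers
      \<open>i * r i\<close> and the sum of sets \<open>?X r\<close>.\<close>
    have sum_r': "(\<Sum>i\<in>?S. h i (r' i)) = x + (\<Sum>i\<in>?S. h i (r i))"
      if "h k (Suc (r k)) = x + h k (r k)" for h :: "nat \<Rightarrow> nat \<Rightarrow> 'b::comm_monoid_add" and x
      using that sum.remove[OF _ *(2), of "\<lambda>i. h i (r' i)"] sum.remove[OF _ *(2), of "\<lambda>i. h i (r i)"]
      by (simp add: r'_def ac_simps)
    have "r' \<in> ?S \<rightarrow>\<^sub>E UNIV" using r(1) *(2) by (auto simp: r'_def PiE_def extensional_def)
    moreover have "s = (\<Sum>i\<in>?S. i * r' i)"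
      using sum_r'[of "(*)" k] r(2) *(3) by simp
    moreover have "?X r' = cover_exponents k + ?X r"
      by (rule sum_r') (simp add: add.commute)
    then have "a \<in> ?X r' + UNIV"
      using *(1,4) r(3) by (auto simp: add.assoc)
    ultimately show ?thesis by blast
  qed
qed

lemma sum_sum_cover_exponents_subset:
  "(\<Sum>i\<in>S. \<Sum>j<r i. cover_exponents i) \<subseteq> cover_exponents (\<Sum>i\<in>S. i * r i)"
proof (induction S rule: infinite_finite_induct)
  case (insert i S)
  have "(\<Sum>j<r i. cover_exponents i) \<subseteq> cover_exponents (i * r i)"
    using sum_cover_exponents[of "\<lambda>_. i" "{..<r i}"] by (simp add: mult.commute)
  from subset_trans[OF set_plus_mono2[OF this insert.IH] cover_exponents_plus] show ?case
    using insert.hyps by simp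
qed auto

section \<open>Primary components\<close>

lemma split_keys:
  fixes f :: "'a \<Rightarrow>\<^sub>0 'b::ab_group_add"
  obtains g h where "f = g + h" "Poly_Mapping.keys g = Poly_Mapping.keys f \<inter> S"
    "Poly_Mapping.keys h = Poly_Mapping.keys f - S"
proof -
  define g where "g = Abs_poly_mapping (\<lambda>c. if c \<in> S then Poly_Mapping.lookup f c else 0)"
  have "finite {c. (if c \<in> S then Poly_Mapping.lookup f c else 0) \<noteq> 0}"
    by (rule finite_subset[OF _ finite_keys[of f]]) (auto simp: in_keys_iff)
  then have "Poly_Mapping.lookup g c = (if c \<in> S then Poly_Mapping.lookup f c else 0)" for c
    by (simp add: g_def)
  then have "Poly_Mapping.keys g = Poly_Mapping.keys f \<inter> S"
    "Poly_Mapping.keys (f - g) = Poly_Mapping.keys f - S"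
    by (auto simp: in_keys_iff lookup_minus split: if_splits)
  then show thesis using that[of g "f - g"] by simp
qed

text \<open>The product of the parts of \<open>f\<close> and \<open>g\<close> of least weight is nonzero and has no cancellation
  with the remaining terms of \<open>f * g\<close>.\<close>

lemma least_weight_mult:
  fixes f g :: "('v::linorder \<Rightarrow>\<^sub>0 nat) \<Rightarrow>\<^sub>0 'k::field" and w :: "('v \<Rightarrow>\<^sub>0 nat) \<Rightarrow> nat"
  assumes w: "\<And>a b. w (a + b) = w a + w b" and nz: "f \<noteq> 0" "g \<noteq> 0"
  obtains a b where "a + b \<in> Poly_Mapping.keys (f * g)"
    "\<And>a'. a' \<in> Poly_Mapping.keys f \<Longrightarrow> w a \<le> w a'" "\<And>b'. b' \<in> Poly_Mapping.keys g \<Longrightarrow> w b \<le> w b'"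
proof -
  have least: "\<exists>m f0 f1. f = f0 + f1 \<and> f0 \<noteq> 0 \<and> (\<forall>a\<in>Poly_Mapping.keys f0. w a = m) \<and>
      (\<forall>a\<in>Poly_Mapping.keys f1. m < w a) \<and> (\<forall>a\<in>Poly_Mapping.keys f. m \<le> w a)"
    if nz: "f \<noteq> 0" for f :: "('v \<Rightarrow>\<^sub>0 nat) \<Rightarrow>\<^sub>0 'k"
  proof -
    define m where "m = Min (w ` Poly_Mapping.keys f)"
    obtain f0 f1 where f: "f = f0 + f1" "Poly_Mapping.keys f0 = Poly_Mapping.keys f \<inter> {a. w a = m}"
      "Poly_Mapping.keys f1 = Poly_Mapping.keys f - {a. w a = m}" by (rule split_keys)
    have ne: "Poly_Mapping.keys f \<noteq> {}"
      using nz by simp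
    then have "m \<in> w ` Poly_Mapping.keys f" unfolding m_def by (intro Min_in) auto
    then have "Poly_Mapping.keys f0 \<noteq> {}" using f(2) by auto
    then have "f0 \<noteq> 0" by auto
    moreover have le: "\<forall>a\<in>Poly_Mapping.keys f. m \<le> w a"
      by (simp add: m_def)
    moreover have "\<forall>a\<in>Poly_Mapping.keys f0. w a = m" unfolding f(2) by simp
    moreover have "\<forall>a\<in>Poly_Mapping.keys f1. m < w a"
      unfolding f(3) using le by (auto simp: less_le)
    ultimately show ?thesis using f(1) by blast
  qed
  obtain m f0 f1 where f: "f = f0 + f1" "f0 \<noteq> 0" "\<forall>a\<in>Poly_Mapping.keys f0. w a = m"
    "\<forall>a\<in>Poly_Mapping.keys f1. m < w a" "\<forall>a\<in>Poly_Mapping.keys f. m \<le> w a" using least[OF nz(1)] by blast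
  obtain k g0 g1 where g: "g = g0 + g1" "g0 \<noteq> 0" "\<forall>a\<in>Poly_Mapping.keys g0. w a = k"
    "\<forall>a\<in>Poly_Mapping.keys g1. k < w a" "\<forall>a\<in>Poly_Mapping.keys g. k \<le> w a" using least[OF nz(2)] by blast
  have "f0 * g0 \<noteq> 0" using f(2) g(2) by simp
  then obtain c where c: "c \<in> Poly_Mapping.keys (f0 * g0)"
    by (metis all_not_in_conv keys_eq_empty)
  then obtain a b where ab: "c = a + b" "a \<in> Poly_Mapping.keys f0" "b \<in> Poly_Mapping.keys g0"
    using keys_mult[of f0 g0] by auto
  have wab: "w a = m" "w b = k" using ab f(3) g(3) by auto
  \<comment> \<open>The exponent \<open>c\<close> has weight exactly \<open>m + k\<close>, so
    products with only heavier exponents cannot affect its coefficient.\<close>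
  have zero: "Poly_Mapping.lookup (p * q) c = 0"
    if "\<And>a b. a \<in> Poly_Mapping.keys p \<Longrightarrow> b \<in> Poly_Mapping.keys q \<Longrightarrow> m + k < w (a + b)"
    for p q :: "('v \<Rightarrow>\<^sub>0 nat) \<Rightarrow>\<^sub>0 'k"
  proof (rule ccontr)
    assume "Poly_Mapping.lookup (p * q) c \<noteq> 0"
    then obtain a' b' where "c = a' + b'" "a' \<in> Poly_Mapping.keys p" "b' \<in> Poly_Mapping.keys q"
      using keys_mult[of p q] by (auto simp: in_keys_iff)
    then show False using that[of a' b'] wab ab(1) w[of a b] by simp
  qed
  have "f * g = f0 * g0 + f0 * g1 + f1 * g" using f(1) g(1) by (simp add: algebra_simps)
  moreover have "Poly_Mapping.lookup (f0 * g1) c = 0"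
    using f(3) g(4) by (intro zero) (simp add: w)
  moreover have "Poly_Mapping.lookup (f1 * g) c = 0"
    using f(4) g(5) by (intro zero) (simp add: w add_less_le_mono)
  ultimately have "c \<in> Poly_Mapping.keys (f * g)" using c by (simp add: in_keys_iff lookup_add)
  moreover have "w a \<le> w a'" if "a' \<in> Poly_Mapping.keys f" for a'
    using that f(5) wab by simp
  moreover have "w b \<le> w b'" if "b' \<in> Poly_Mapping.keys g" for b'
    using that g(5) wab by simp
  ultimately show thesis using that ab(1) by blast
qed

text \<open>The power \<open>P\<^sub>V\<^sup>s\<close> for the minimal cover \<open>V = - {v}\<close>.\<close>

definition cover_power :: "'v::finite \<Rightarrow> nat \<Rightarrow> (('v \<Rightarrow>\<^sub>0 nat) \<Rightarrow>\<^sub>0 'k::field) set"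
  where "cover_power v s = {f. \<forall>a\<in>Poly_Mapping.keys f. s \<le> weight (- {v}) a}"

text \<open>The right side is the intersection of the powers of the cover primes. Upward closure of
  \<open>cover_exponents s\<close> makes both sides conditions on single terms.\<close>

lemma monomial_ideal_cover_exponents:
  "monomial_ideal (cover_exponents s) = (\<Inter>v. cover_power v s)"
  unfolding monomial_ideal_def cover_exponents_upward
  by (auto simp: cover_power_def cover_exponents_def)

text \<open>Outside the cover prime, \<open>f\<close> has a term of weight 0, so its least weight is
  0 and the least weight of \<open>g\<close> already occurs in \<open>f * g\<close>. For
  \<open>s = 1\<close> this is primality.\<close>

lemma cover_power_primary:
  fixes f g :: "('v::{finite, linorder} \<Rightarrow>\<^sub>0 nat) \<Rightarrow>\<^sub>0 'k::field"
  assumes fg: "f * g \<in> cover_power v s" and f: "f \<notin> cover_power v 1"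
  shows "g \<in> cover_power v s"
proof (cases "g = 0")
  case False
  have "f \<noteq> 0" using f by (auto simp: cover_power_def)
  obtain a b where ab: "a + b \<in> Poly_Mapping.keys (f * g)"
    "\<And>a'. a' \<in> Poly_Mapping.keys f \<Longrightarrow> weight (- {v}) a \<le> weight (- {v}) a'"
    "\<And>b'. b' \<in> Poly_Mapping.keys g \<Longrightarrow> weight (- {v}) b \<le> weight (- {v}) b'"
    by (rule least_weight_mult[of "weight (- {v})", OF weight_add \<open>f \<noteq> 0\<close> False]) (rule that)
  obtain a' where "a' \<in> Poly_Mapping.keys f" "weight (- {v}) a' = 0"
    using f by (auto simp: cover_power_def)
  then have "weight (- {v}) a = 0" using ab(2) by fastforce
  moreover have "s \<le> weight (- {v}) (a + b)" using fg ab(1) by (auto simp: cover_power_def)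
  ultimately have "s \<le> weight (- {v}) b" by (simp add: weight_add)
  then show ?thesis using ab(3) by (force simp: cover_power_def)
qed (simp add: cover_power_def)

lemma primeideal_cover_power:
  "primeideal (cover_power v 1 :: (('v::{finite, linorder} \<Rightarrow>\<^sub>0 nat) \<Rightarrow>\<^sub>0 'k::field) set) ring_of_type_algebra"
  (is "primeideal ?P _")
proof (rule primeidealI)
  show "ideal ?P ring_of_type_algebra"
  proof (rule ideal_of_type_algebraI)
    fix x y r :: "('v \<Rightarrow>\<^sub>0 nat) \<Rightarrow>\<^sub>0 'k"
    assume x: "x \<in> ?P"
    show "r * x \<in> ?P"
      using x keys_mult[of r x] by (fastforce simp: cover_power_def weight_add)
    assume "y \<in> ?P"
    then show "x + y \<in> ?P"
      using x Poly_Mapping.keys_add[of x y] by (fastforce simp: cover_power_def)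
  qed (simp add: cover_power_def)
  have "1 \<notin> ?P" by (simp add: cover_power_def weight_def)
  then show "carrier ring_of_type_algebra \<noteq> ?P" by auto
  fix x y :: "('v \<Rightarrow>\<^sub>0 nat) \<Rightarrow>\<^sub>0 'k"
  assume "x \<otimes>\<^bsub>ring_of_type_algebra\<^esub> y \<in> ?P"
  then show "x \<in> ?P \<or> y \<in> ?P" using cover_power_primary[of x y v 1] by simp blast
qed (rule cring_from_type_algebra)


section \<open>Symbolic powers of the edge ideal of a complete graph\<close>

lemma edge_ideal_eq_edge_exponents:
  "(edge_ideal complete_graph :: (('v \<Rightarrow>\<^sub>0 nat) \<Rightarrow>\<^sub>0 'k::field) set) = monomial_ideal edge_exponents"
proof -
  have "{var u * var v :: ('v \<Rightarrow>\<^sub>0 nat) \<Rightarrow>\<^sub>0 'k | u v. {u, v} \<in> complete_graph} = monomial ` edge_exponents"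
    by (auto simp: var_def monomial_mult edge_exponents_def complete_graph_def doubleton_eq_iff)
  then show ?thesis by (simp add: edge_ideal_def genideal_monomials)
qed

text \<open>Generation by edges describes the ordinary powers; this second form gives the
  intersection of cover primes and lets the edge ideal enter products on the same footing as the
  symbolic powers.\<close>

lemma edge_ideal_complete_graph:
  "(edge_ideal complete_graph :: (('v::finite \<Rightarrow>\<^sub>0 nat) \<Rightarrow>\<^sub>0 'k::field) set) =
    monomial_ideal (cover_exponents 1)"
  unfolding edge_ideal_eq_edge_exponents monomial_ideal_def edge_exponents_upward
    cover_exponents_upward ..

lemma edge_ideal_power:
  "edge_ideal complete_graph [^]\<^bsub>ideals\<^esub> (s::nat) = monomial_ideal (\<Sum>i<s. edge_exponents)"
  by (simp add: edge_ideal_eq_edge_exponents pow_ideals)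

lemma var_notin_cover_power: "var v \<notin> cover_power v 1"
  by (simp add: var_def cover_power_def weight_single)

text \<open>Multiplying by \<open>var v\<close> raises the weight on every cover except
  \<open>- {v}\<close>. Hence the prime of that cover is the annihilator of the class of
  \<open>var v\<close>.\<close>

lemma cover_power_associated:
  "(cover_power v 1 :: (('v::{finite, linorder} \<Rightarrow>\<^sub>0 nat) \<Rightarrow>\<^sub>0 'k::field) set)
    \<in> associated_primes (edge_ideal complete_graph)"
proof -
  let ?I = "edge_ideal complete_graph :: (('v \<Rightarrow>\<^sub>0 nat) \<Rightarrow>\<^sub>0 'k) set"
  have "r \<in> cover_power v 1 \<longleftrightarrow> r * var v \<in> ?I" for r :: "('v \<Rightarrow>\<^sub>0 nat) \<Rightarrow>\<^sub>0 'k"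
  proof
    assume r: "r \<in> cover_power v 1"
    have "a + Poly_Mapping.single v 1 \<in> cover_exponents 1" if "a \<in> Poly_Mapping.keys r" for a
      using r that by (auto simp: cover_power_def cover_exponents_def weight_add weight_single)
    moreover have "Poly_Mapping.keys (r * var v) \<subseteq>
        {a + Poly_Mapping.single v 1 | a. a \<in> Poly_Mapping.keys r}"
      using keys_mult[of r "var v"] by (simp add: var_def)
    ultimately show "r * var v \<in> ?I"
      unfolding edge_ideal_complete_graph monomial_ideal_def cover_exponents_upward by blast
  next
    assume "r * var v \<in> ?I"
    then have "var v * r \<in> cover_power v 1"
      by (simp add: edge_ideal_complete_graph monomial_ideal_cover_exponents mult.commute)
    then show "r \<in> cover_power v 1" using cover_power_primary var_notin_cover_power by blast
  qed
  then have "cover_power v 1 = {r. r * var v \<in> ?I}" by blast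
  then show ?thesis
    unfolding associated_primes_def using primeideal_cover_power by blast
qed

text \<open>If \<open>p\<close> is the annihilator of the class of \<open>g\<close>, then
  \<open>g\<close> lies outside the edge ideal, hence outside the prime of some cover
  \<open>- {v}\<close>. That prime omits \<open>var v\<close> too, hence also
  \<open>var v * g\<close>.\<close>

lemma associated_prime_omits_variable:
  fixes p :: "(('v::{finite, linorder} \<Rightarrow>\<^sub>0 nat) \<Rightarrow>\<^sub>0 'k::field) set"
  assumes "p \<in> associated_primes (edge_ideal complete_graph)"
  obtains v where "var v \<notin> p"
proof -
  obtain g where p: "primeideal p ring_of_type_algebra" "p = {r. r * g \<in> edge_ideal complete_graph}"
    using assms by (auto simp: associated_primes_def)
  then have "g \<notin> edge_ideal complete_graph" using primeideal_of_type_algebra(2)[OF p(1)] by simp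
  then obtain v where v: "g \<notin> cover_power v 1"
    by (auto simp: edge_ideal_complete_graph monomial_ideal_cover_exponents)
  have "var v \<notin> p"
  proof
    assume "var v \<in> p"
    then have "var v * g \<in> cover_power v 1"
      using p(2) by (auto simp: edge_ideal_complete_graph monomial_ideal_cover_exponents)
    then show False using cover_power_primary var_notin_cover_power v by blast
  qed
  then show thesis by (rule that)
qed

lemma symbolic_power_edge_ideal:
  "symbolic_power (edge_ideal complete_graph :: (('v::{finite, linorder} \<Rightarrow>\<^sub>0 nat) \<Rightarrow>\<^sub>0 'k::field) set) s =
    monomial_ideal (cover_exponents s)"
proof
  let ?I = "edge_ideal complete_graph :: (('v \<Rightarrow>\<^sub>0 nat) \<Rightarrow>\<^sub>0 'k) set"
  have ideal: "ideal (?I [^]\<^bsub>ideals\<^esub> s) ring_of_type_algebra"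
    by (simp add: edge_ideal_power)
  have sub: "?I [^]\<^bsub>ideals\<^esub> s \<subseteq> monomial_ideal (cover_exponents s)"
    unfolding edge_ideal_power
    by (rule monomial_ideal_mono) (use sum_edge_exponents_subset[of s] in simp)
  show "symbolic_power ?I s \<subseteq> monomial_ideal (cover_exponents s)"
    unfolding monomial_ideal_cover_exponents
  proof (intro subsetI INT_I)
    fix f v assume "f \<in> symbolic_power ?I s"
    then have "f \<in> saturation (cover_power v 1) (?I [^]\<^bsub>ideals\<^esub> s)"
      using cover_power_associated by (auto simp: symbolic_power_def)
    then obtain b where "b \<notin> cover_power v 1" "b * f \<in> ?I [^]\<^bsub>ideals\<^esub> s"
      using saturation_iff[OF primeideal_cover_power ideal] by blast
    moreover from this have "b * f \<in> cover_power v s"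
      using sub unfolding monomial_ideal_cover_exponents by blast
    ultimately show "f \<in> cover_power v s" using cover_power_primary by blast
  qed
  show "monomial_ideal (cover_exponents s) \<subseteq> symbolic_power ?I s"
  proof
    fix f :: "('v \<Rightarrow>\<^sub>0 nat) \<Rightarrow>\<^sub>0 'k" assume f: "f \<in> monomial_ideal (cover_exponents s)"
    have "f \<in> saturation p (?I [^]\<^bsub>ideals\<^esub> s)" if p: "p \<in> associated_primes ?I" for p
    proof -
      have prime: "primeideal p ring_of_type_algebra" using p by (simp add: associated_primes_def)
      obtain v where v: "var v \<notin> p" using associated_prime_omits_variable[OF p] .
      have "var v ^ s \<notin> p"
        by (induction s) (use v primeideal_of_type_algebra(2,3)[OF prime] in auto)
      moreover have "var v ^ s * f \<in> ?I [^]\<^bsub>ideals\<^esub> s"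
      proof -
        let ?e = "Poly_Mapping.single v s"
        have var_pow: "var v ^ s = (monomial ?e :: ('v \<Rightarrow>\<^sub>0 nat) \<Rightarrow>\<^sub>0 'k)"
          by (induction s) (simp_all add: var_def monomial_mult flip: single_add, simp add: monomial_def)
        have "?e + a \<in> (\<Sum>i<s. edge_exponents) + UNIV" if "a \<in> Poly_Mapping.keys f" for a
        proof (rule edge_sum_if_large_degree)
          have a: "a \<in> cover_exponents s" using f that by (auto simp: monomial_ideal_def)
          then show "?e + a \<in> cover_exponents s" using cover_exponents_add[of ?e 0 a s] by simp
          \<comment> \<open>The factor adds \<open>s\<close> at \<open>v\<close>, outside the cover
            \<open>- {v}\<close> on which \<open>a\<close> already has weight at least
            \<open>s\<close>; this gives the degree needed for the greedy matching.\<close>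
          have "s \<le> weight (- {v}) a" using a by (simp add: cover_exponents_def)
          then show "2 * s \<le> weight UNIV (?e + a)"
            using weight_UNIV[of a v] by (simp add: weight_add weight_single)
        qed
        moreover have "Poly_Mapping.keys (var v ^ s * f) \<subseteq> {?e + a | a. a \<in> Poly_Mapping.keys f}"
          using keys_mult[of "monomial ?e" f] by (simp add: var_pow)
        ultimately show ?thesis
          unfolding edge_ideal_power monomial_ideal_def by blast
      qed
      ultimately show ?thesis using saturation_iff[OF prime ideal] by blast
    qed
    then show "f \<in> symbolic_power ?I s" by (simp add: symbolic_power_def)
  qed
qed

section \<open>Minimal vertex covers, generators of low degree and index tuples\<close>

lemma minimal_vertex_cover_complete_graph:
  "minimal_vertex_cover complete_graph V \<longleftrightarrow> (\<exists>v. V = - {v})"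
proof -
  have cover: "vertex_cover complete_graph U \<longleftrightarrow> (\<forall>u v. u \<noteq> v \<longrightarrow> u \<in> U \<or> v \<in> U)" for U :: "'a set"
    by (auto simp: vertex_cover_def complete_graph_def)
  show ?thesis
  proof
    assume V: "minimal_vertex_cover complete_graph V"
    \<comment> \<open>Removing any one vertex, here \<open>undefined\<close>, from the full set
      leaves a cover.\<close>
    have "V \<noteq> UNIV"
    proof
      assume "V = UNIV"
      moreover have "vertex_cover complete_graph (- {undefined :: 'a})" by (auto simp: cover)
      ultimately show False using V by (auto simp: minimal_vertex_cover_def)
    qed
    then obtain v where "v \<notin> V" by auto
    \<comment> \<open>A cover that omits \<open>v\<close> must contain every other vertex.\<close>
    then have "V = - {v}" using V by (auto simp: minimal_vertex_cover_def cover)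
    then show "\<exists>v. V = - {v}" ..
  next
    assume "\<exists>v. V = - {v}"
    then obtain v where "V = - {v}" ..
    then show "minimal_vertex_cover complete_graph V"
      by (auto simp: minimal_vertex_cover_def cover)
  qed
qed

lemma D_complete_graph:
  "D complete_graph s = monomial ` {a \<in> cover_exponents s. weight UNIV a < 2 * s}"
  by (auto simp: D_def cover_exponents_def minimal_vertex_cover_complete_graph)

text \<open>Since \<open>i \<ge> 1\<close>, each \<open>r i\<close> is at most \<open>s\<close>.
  Finiteness allows the sum of ideals over these tuples to be computed by
  \<open>finsum_ideals\<close>.\<close>

lemma finite_weighted_compositions:
  "finite {r \<in> {1..m} \<rightarrow>\<^sub>E (UNIV :: nat set). s = (\<Sum>i = 1..m. i * r i)}"
proof (rule finite_subset)
  show "finite ({1..m} \<rightarrow>\<^sub>E {..s})" by (intro finite_PiE) auto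
  have "r i \<le> (\<Sum>i = 1..m. i * r i)" if "i \<in> {1..m}" for r i
  proof -
    have "r i \<le> i * r i" using that by simp
    also have "\<dots> \<le> (\<Sum>i = 1..m. i * r i)" using that by (intro member_le_sum) auto
    finally show ?thesis .
  qed
  then show "{r \<in> {1..m} \<rightarrow>\<^sub>E UNIV. s = (\<Sum>i = 1..m. i * r i)} \<subseteq> {1..m} \<rightarrow>\<^sub>E {..s}"
    by (fastforce simp: PiE_def)
qed

theorem theorem4p2:
  fixes n :: nat
    and G :: "'v::{finite, linorder} set set"
    and I :: "(('v \<Rightarrow>\<^sub>0 nat) \<Rightarrow>\<^sub>0 'k::field) set"
  assumes "n = card (UNIV :: 'v set)" and "n \<ge> 2"
    and "G = complete_graph"
    and "I = edge_ideal G"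
  shows "(\<forall>s::nat. 1 \<le> s \<and> s \<le> n - 1 \<longrightarrow>
            symbolic_power I s =
              (I [^]\<^bsub>ideals\<^esub> s) \<oplus>\<^bsub>ideals\<^esub> (Idl\<^bsub>ring_of_type_algebra\<^esub> (D G s))) \<and>
         (\<forall>s\<ge>n.
            symbolic_power I s =
              (\<Oplus>\<^bsub>ideals\<^esub>r\<in>{r \<in> {1..n - 1} \<rightarrow>\<^sub>E (UNIV :: nat set). s = (\<Sum>i = 1..n - 1. i * r i)}.
                 (I [^]\<^bsub>ideals\<^esub> r 1) \<otimes>\<^bsub>ideals\<^esub>
                 (\<Otimes>\<^bsub>ideals\<^esub>i\<in>{2..n - 1}. symbolic_power I i [^]\<^bsub>ideals\<^esub> r i)))"
proof (intro conjI allI impI)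
  fix s :: nat
  let ?D = "{a \<in> cover_exponents s. weight UNIV a < 2 * s} :: ('v \<Rightarrow>\<^sub>0 nat) set"
  let ?E = "\<Sum>i<s. edge_exponents :: ('v \<Rightarrow>\<^sub>0 nat) set"
  \<comment> \<open>Exponents of degree below \<open>2 * s\<close> come from \<open>D\<close>; the
    others dominate a sum of \<open>s\<close> edges.\<close>
  have "cover_exponents s \<subseteq> (?E \<union> ?D) + UNIV"
  proof
    fix a :: "'v \<Rightarrow>\<^sub>0 nat" assume a: "a \<in> cover_exponents s"
    show "a \<in> (?E \<union> ?D) + UNIV"
    proof (cases "weight UNIV a < 2 * s")
      case True
      with a have "a \<in> ?D" by blast
      then show ?thesis using plus_UNIV_superset[of "?E \<union> ?D"] by blast
    next
      case False
      then have "a \<in> ?E + UNIV" using edge_sum_if_large_degree[OF a] by linarith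
      then show ?thesis unfolding Un_set_plus by blast
    qed
  qed
  moreover have "?E \<union> ?D \<subseteq> cover_exponents s + UNIV"
    unfolding cover_exponents_upward using sum_edge_exponents_subset[of s] by blast
  ultimately have "monomial_ideal (cover_exponents s) = (monomial_ideal (?E \<union> ?D) :: (_ \<Rightarrow>\<^sub>0 'k) set)"
    by (intro equalityI monomial_ideal_mono)
  then show "symbolic_power I s = (I [^]\<^bsub>ideals\<^esub> s) \<oplus>\<^bsub>ideals\<^esub> (Idl\<^bsub>ring_of_type_algebra\<^esub> (D G s))"
    by (simp add: assms(3,4) symbolic_power_edge_ideal edge_ideal_power D_complete_graph
        genideal_monomials add_ideals)
next
  fix s :: nat
  let ?R = "{r \<in> {1..n - 1} \<rightarrow>\<^sub>E (UNIV :: nat set). s = (\<Sum>i = 1..n - 1. i * r i)}"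
  let ?X = "\<lambda>r. \<Sum>i = 1..n - 1. \<Sum>j<r i. cover_exponents i :: ('v \<Rightarrow>\<^sub>0 nat) set"
  have factor: "(I [^]\<^bsub>ideals\<^esub> r 1) \<otimes>\<^bsub>ideals\<^esub>
      (\<Otimes>\<^bsub>ideals\<^esub>i\<in>{2..n - 1}. symbolic_power I i [^]\<^bsub>ideals\<^esub> r i) = monomial_ideal (?X r)"
    for r :: "nat \<Rightarrow> nat"
  proof -
    \<comment> \<open>As \<open>n \<ge> 2\<close>, the index 1 is in range, and the power of
      \<open>I\<close> in front becomes the first summand of \<open>?X r\<close>.\<close>
    have "{1..n - 1} = insert 1 {2..n - 1}" using assms(2) by auto
    then have X: "?X r = (\<Sum>j<r 1. cover_exponents 1) + (\<Sum>i = 2..n - 1. \<Sum>j<r i. cover_exponents i)"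
      by simp
    show ?thesis
      unfolding X assms(3,4) symbolic_power_edge_ideal
      unfolding edge_ideal_complete_graph pow_ideals finprod_ideals[OF finite_atLeastAtMost]
        mult_ideals ..
  qed
  \<comment> \<open>The sum of the ideals is the ideal of the union, so a single suitable tuple for
    each exponent is enough.\<close>
  have "cover_exponents s \<subseteq> (\<Union>r\<in>?R. ?X r) + UNIV"
  proof
    fix a :: "'v \<Rightarrow>\<^sub>0 nat" assume "a \<in> cover_exponents s"
    then obtain r where "r \<in> ?R" "a \<in> ?X r + UNIV"
      using cover_exponents_decomposition[of a s] assms(1) by auto
    then show "a \<in> (\<Union>r\<in>?R. ?X r) + UNIV"
      using set_plus_mono2[of "?X r" "\<Union>r\<in>?R. ?X r" UNIV UNIV] by blast
  qed
  moreover have "(\<Union>r\<in>?R. ?X r) \<subseteq> cover_exponents s + UNIV"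
    unfolding cover_exponents_upward using sum_sum_cover_exponents_subset by blast
  ultimately have "monomial_ideal (cover_exponents s) =
      (monomial_ideal (\<Union>r\<in>?R. ?X r) :: (_ \<Rightarrow>\<^sub>0 'k) set)"
    by (intro equalityI monomial_ideal_mono)
  then show "symbolic_power I s =
      (\<Oplus>\<^bsub>ideals\<^esub>r\<in>?R. (I [^]\<^bsub>ideals\<^esub> r 1) \<otimes>\<^bsub>ideals\<^esub>
         (\<Otimes>\<^bsub>ideals\<^esub>i\<in>{2..n - 1}. symbolic_power I i [^]\<^bsub>ideals\<^esub> r i))"
    unfolding factor finsum_ideals[OF finite_weighted_compositions]
    by (simp add: assms(3,4) symbolic_power_edge_ideal)
qed

end
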